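(* Let $X$ be a metric space and, for each $n \in \mathbb{N} \cup \{\infty\}$, let $\mu^{(n)} \in \mathcal{P}(X)$ have an Onsager--Machlup functional $I^{(n)} \colon E^{(n)} \to \mathbb{R}$ such that property $M(\mu^{(n)}, E^{(n)})$ is satisfied. Extend each $I^{(n)}$ to take the value $+\infty$ on $X \setminus E^{(n)}$. Suppose that the sequence $(I^{(n)})_{n \in \mathbb{N}}$ (of extended functionals $X \to \overline{\mathbb{R}}$) is equicoercive and $\Gamma$-converges to $I^{(\infty)}$. Then, if $u^{(n)}$ is a global weak mode of $\mu^{(n)}$ for each $n \in \mathbb{N}$, every convergent subsequence of $(u^{(n)})_{n \in \mathbb{N}}$ has as its limit a global weak mode of $\mu^{(\infty)}$.
   Context: For a metric space $X$, $\mathcal{P}(X)$ is the set of Borel probability measures on $X$, $B_r(x)$ is the open ball of radius $r$ centred at $x$, and $\overline{\mathbb{R}} = \mathbb{R} \cup \{\pm\infty\}$. The support of $\mu \in \mathcal{P}(X)$ is $\operatorname{supp}(\mu) = \{x \in X : \mu(B_r(x)) > 0 \text{ for all } r > 0\}$. Onsager--Machlup (OM) functional: for a nonempty set $E \subseteq \operatorname{supp}(\mu)$, a function $I \colon E \to \mathbb{R}$ is an OM functional for $\mu$ if $\lim_{r \searrow 0} \frac{\mu(B_r(x_1))}{\mu(B_r(x_2))} = \exp(I(x_2) - I(x_1))$ for all $x_1, x_2 \in E$. Property $M(\mu, E)$: there is some $x^\star \in E$ such that for every $x \in X \setminus E$, $\lim_{r \searrow 0} \frac{\mu(B_r(x))}{\mu(B_r(x^\star))}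 = 0$. Global weak mode: a point $u \in \operatorname{supp}(\mu)$ such that for every $u' \in X$, $\limsup_{r \searrow 0} \frac{\mu(B_r(u'))}{\mu(B_r(u))} \leq 1$. $\Gamma$-convergence: functions $F_n \colon X \to \overline{\mathbb{R}}$ $\Gamma$-converge to $F \colon X \to \overline{\mathbb{R}}$ if for every $x \in X$: (i) for every sequence $x_n \to x$, $F(x) \leq \liminf_{n} F_n(x_n)$; and (ii) there exists a sequence $x_n \to x$ with $F(x) \geq \limsup_{n} F_n(x_n)$. Equicoercivity: $(F_n)_{n \in \mathbb{N}}$ is equicoercive if for all $t \in \mathbb{R}$ there is a compact $K_t \subseteq X$ such that $F_n^{-1}([-\infty, t]) \subseteq K_t$ for all $n \in \mathbb{N}$. *)

theory Defs
  imports "HOL-Analysis.Analysis" "HOL-Probability.Probability_Measure"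
begin

definition borel_prob :: "'a::topological_space measure \<Rightarrow> bool" where
  "borel_prob M \<longleftrightarrow> prob_space M \<and> sets M = sets borel"

definition measure_supp :: "'a::metric_space measure \<Rightarrow> 'a set" where
  "measure_supp M = {x. \<forall>r>0. measure M (ball x r) > 0}"

text \<open>
  In the ball-mass ratios below the denominator is centred at a point of the support
  (in \<open>property_M\<close> this is the case once \<open>E\<close> is the domain of an
  Onsager--Machlup functional), so the convention \<open>x / 0 = 0\<close> plays no role.
  Functionals on \<open>E\<close> are total functions whose values outside \<open>E\<close> are never used.
\<close>

definition OM_functional :: "'a::metric_space measure \<Rightarrow> 'a set \<Rightarrow> ('a \<Rightarrow> real) \<Rightarrow> bool" where
  "OM_functional M E I \<longleftrightarrow>
     E \<noteq> {} \<and> E \<subseteq> measure_supp M \<and>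
     (\<forall>x1\<in>E. \<forall>x2\<in>E.
        ((\<lambda>r. measure M (ball x1 r) / measure M (ball x2 r)) \<longlongrightarrow> exp (I x2 - I x1)) (at_right 0))"

definition property_M :: "'a::metric_space measure \<Rightarrow> 'a set \<Rightarrow> bool" where
  "property_M M E \<longleftrightarrow>
     (\<exists>xs\<in>E. \<forall>x. x \<notin> E \<longrightarrow>
        ((\<lambda>r. measure M (ball x r) / measure M (ball xs r)) \<longlongrightarrow> 0) (at_right 0))"

definition global_weak_mode :: "'a::metric_space measure \<Rightarrow> 'a \<Rightarrow> bool" where
  "global_weak_mode M u \<longleftrightarrow>
     u \<in> measure_supp M \<and>
     (\<forall>u'. Limsup (at_right 0) (\<lambda>r. ereal (measure M (ball u' r) / measure M (ball u r))) \<le> 1)"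

definition extend_infty :: "'a set \<Rightarrow> ('a \<Rightarrow> real) \<Rightarrow> 'a \<Rightarrow> ereal" where
  "extend_infty E I x = (if x \<in> E then ereal (I x) else \<infinity>)"

definition Gamma_converges :: "(nat \<Rightarrow> 'a::metric_space \<Rightarrow> ereal) \<Rightarrow> ('a \<Rightarrow> ereal) \<Rightarrow> bool" where
  "Gamma_converges F G \<longleftrightarrow>
     (\<forall>x. (\<forall>y. y \<longlonglongrightarrow> x \<longrightarrow> G x \<le> liminf (\<lambda>n. F n (y n))) \<and>
          (\<exists>y. y \<longlonglongrightarrow> x \<and> G x \<ge> limsup (\<lambda>n. F n (y n))))"

definition equicoercive :: "(nat \<Rightarrow> 'a::metric_space \<Rightarrow> ereal) \<Rightarrow> bool" where
  "equicoercive F \<longleftrightarrow>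
     (\<forall>t::real. \<exists>K. compact K \<and> (\<forall>n. F n -` {-\<infinity>..ereal t} \<subseteq> K))"

end

theory Submission
  imports Defs
begin

text \<open>
  The proof separates measure theory from variational analysis. Ball-mass ratios enter only
  through the equivalence of \<open>global_weak_mode_iff_minimiser\<close>: a point is a global
  weak mode exactly when it minimises the functional extended by \<open>\<infinity>\<close>. Within
  \<open>E\<close> this is the definition of an Onsager--Machlup functional, since
  \<open>exp (I u - I x) \<le> 1\<close> says \<open>I u \<le> I x\<close>; property \<open>M\<close> makes the
  small-ball mass of every point outside \<open>E\<close> negligible, which is what the value
  \<open>\<infinity>\<close> there expresses.

  What is left is the classical fact \<open>Gamma_limit_of_minimisers\<close> that limits of minimisers
  of \<open>F n\<close> minimise the \<open>\<Gamma>\<close>-limit: the lower bound at the limit point, minimality,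
  and a recovery sequence at a competitor give the required chain of inequalities. The minimum
  found in this way is finite because \<open>E \<infinity>\<close> is nonempty, so the limit point does lie in
  \<open>E \<infinity>\<close> and is a mode.
\<close>

lemma global_weak_mode_iff_minimiser:
  fixes \<mu> :: "'a::metric_space measure"
  assumes OM: "OM_functional \<mu> E I" and M: "property_M \<mu> E"
  shows "global_weak_mode \<mu> u \<longleftrightarrow> (\<forall>x. extend_infty E I u \<le> extend_infty E I x)"
proof -
  let ?q = "\<lambda>x y r. measure \<mu> (ball x r) / measure \<mu> (ball y r)"
  have lim: "(?q x y \<longlongrightarrow> exp (I y - I x)) (at_right 0)" if "x \<in> E" "y \<in> E" for x y
    using OM that by (auto simp: OM_functional_def)
  have supp: "E \<subseteq> measure_supp \<mu>"
    using OM by (auto simp: OM_functional_def)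
  obtain z where z: "z \<in> E" and neg: "\<And>x. x \<notin> E \<Longrightarrow> (?q x z \<longlongrightarrow> 0) (at_right 0)"
    using M unfolding property_M_def by blast
  have pos: "eventually (\<lambda>r. measure \<mu> (ball x r) > 0) (at_right 0)" if "x \<in> measure_supp \<mu>" for x
    using that eventually_at_right_less[of "0::real"]
    by (auto simp: measure_supp_def elim: eventually_mono)
  have Limsup_eq: "Limsup (at_right 0) (\<lambda>r. ereal (?q x y r)) = ereal l"
    if "(?q x y \<longlongrightarrow> l) (at_right 0)" for x y l
    using that by (intro lim_imp_Limsup) auto
  show ?thesis
  proof
    assume mode: "global_weak_mode \<mu> u"
    then have u: "u \<in> measure_supp \<mu>"
      and le1: "\<And>x. Limsup (at_right 0) (\<lambda>r. ereal (?q x u r)) \<le> 1"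
      by (auto simp: global_weak_mode_def)
    have uE: "u \<in> E"
    proof (rule ccontr)
      assume "u \<notin> E"
      \<comment> \<open>Negligibility of \<open>u\<close> against \<open>z\<close> forces the reciprocal ratio above 2.\<close>
      then have "eventually (\<lambda>r. ?q u z r < 1/2) (at_right 0)"
        by (intro order_tendstoD(2)[OF neg]) auto
      moreover have "eventually (\<lambda>r. measure \<mu> (ball z r) > 0) (at_right 0)"
        using z supp by (intro pos) auto
      ultimately have "eventually (\<lambda>r. 2 \<le> ereal (?q z u r)) (at_right 0)"
        using pos[OF u]
      proof (eventually_elim)
        case (elim r)
        then have "2 \<le> ?q z u r" by (auto simp: field_simps)
        then show ?case by simp
      qed
      then have "2 \<le> Liminf (at_right 0) (\<lambda>r. ereal (?q z u r))"
        by (rule Liminf_bounded)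
      also have "\<dots> \<le> Limsup (at_right 0) (\<lambda>r. ereal (?q z u r))"
        by (intro Liminf_le_Limsup) simp
      also have "\<dots> \<le> 1" by (rule le1)
      finally show False by simp
    qed
    have "I u \<le> I x" if "x \<in> E" for x
      using le1[of x] Limsup_eq[OF lim[OF that uE]] by (simp add: one_ereal_def)
    then show "\<forall>x. extend_infty E I u \<le> extend_infty E I x"
      using uE by (auto simp: extend_infty_def)
  next
    assume min: "\<forall>x. extend_infty E I u \<le> extend_infty E I x"
    have uE: "u \<in> E"
      using min[rule_format, of z] z by (auto simp: extend_infty_def split: if_splits)
    have le: "I u \<le> I x" if "x \<in> E" for x
      using min[rule_format, of x] that uE by (auto simp: extend_infty_def)
    have "Limsup (at_right 0) (\<lambda>r. ereal (?q x u r)) \<le> 1" for x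
    proof (cases "x \<in> E")
      case True
      then show ?thesis
        using Limsup_eq[OF lim[OF True uE]] le[OF True] by (simp add: one_ereal_def)
    next
      case False
      \<comment> \<open>Property \<open>M\<close> compares \<open>x\<close> with \<open>z\<close> only; the finite limiting ratio of
        \<open>z\<close> to \<open>u\<close> carries this over to \<open>u\<close>.\<close>
      have "((\<lambda>r. ?q x z r * ?q z u r) \<longlongrightarrow> 0 * exp (I u - I z)) (at_right 0)"
        by (intro tendsto_mult neg[OF False] lim z uE)
      moreover have "eventually (\<lambda>r. ?q x z r * ?q z u r = ?q x u r) (at_right 0)"
        by (rule eventually_mono[OF pos[of z]]) (use z supp in auto)
      ultimately have "(?q x u \<longlongrightarrow> 0 * exp (I u - I z)) (at_right 0)"
        by (rule Lim_transform_eventually)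
      from Limsup_eq[OF this] show ?thesis by simp
    qed
    then show "global_weak_mode \<mu> u"
      using uE supp by (auto simp: global_weak_mode_def)
  qed
qed

text \<open>
  The \<open>liminf\<close> inequality of \<open>\<Gamma>\<close>-convergence speaks of sequences indexed by all
  natural numbers; filling the gaps of a convergent subsequence with its limit provides one.
\<close>

lemma tendsto_fill_subsequence:
  fixes u :: "nat \<Rightarrow> 'a::topological_space"
  assumes "strict_mono \<phi>" and "(u \<circ> \<phi>) \<longlonglongrightarrow> v"
  shows "(\<lambda>n. if n \<in> range \<phi> then u n else v) \<longlonglongrightarrow> v"
proof (rule topological_tendstoI)
  fix S assume S: "open S" "v \<in> S"
  then obtain K where K: "\<And>k. k \<ge> K \<Longrightarrow> u (\<phi> k) \<in> S"
    using topological_tendstoD[OF assms(2) S] by (auto simp: eventually_sequentially)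
  have "(if n \<in> range \<phi> then u n else v) \<in> S" if "n \<ge> \<phi> K" for n
    using that S K strict_mono_less_eq[OF assms(1)] by auto
  then show "eventually (\<lambda>n. (if n \<in> range \<phi> then u n else v) \<in> S) sequentially"
    unfolding eventually_sequentially by blast
qed

lemma Gamma_limit_of_minimisers:
  fixes F :: "nat \<Rightarrow> 'a::metric_space \<Rightarrow> ereal"
  assumes \<Gamma>: "Gamma_converges F G"
    and min: "\<And>n x. F n (u n) \<le> F n x"
    and \<phi>: "strict_mono \<phi>" and v: "(u \<circ> \<phi>) \<longlonglongrightarrow> v"
  shows "G v \<le> G x"
proof -
  obtain y where y: "limsup (\<lambda>n. F n (y n)) \<le> G x"
    using \<Gamma> unfolding Gamma_converges_def by blast
  define w where "w = (\<lambda>n. if n \<in> range \<phi> then u n else v)"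
  have "w \<longlonglongrightarrow> v"
    unfolding w_def by (rule tendsto_fill_subsequence[OF \<phi> v])
  then have "G v \<le> liminf (\<lambda>n. F n (w n))"
    using \<Gamma> unfolding Gamma_converges_def by blast
  also have "\<dots> \<le> liminf ((\<lambda>n. F n (w n)) \<circ> \<phi>)"
    by (rule liminf_subseq_mono[OF \<phi>])
  also have "\<dots> \<le> liminf ((\<lambda>n. F n (y n)) \<circ> \<phi>)"
    by (intro Liminf_mono always_eventually) (simp add: w_def min)
  also have "\<dots> \<le> limsup ((\<lambda>n. F n (y n)) \<circ> \<phi>)"
    by (intro Liminf_le_Limsup) simp
  also have "\<dots> \<le> limsup (\<lambda>n. F n (y n))"
    by (rule limsup_subseq_mono[OF \<phi>])
  also note y
  finally show ?thesis .
qed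

theorem theorem4p2:
  fixes \<mu> :: "enat \<Rightarrow> 'a::metric_space measure"
    and E :: "enat \<Rightarrow> 'a set"
    and I :: "enat \<Rightarrow> 'a \<Rightarrow> real"
    and u :: "nat \<Rightarrow> 'a"
  assumes "\<And>n. borel_prob (\<mu> n)"
    and "\<And>n. OM_functional (\<mu> n) (E n) (I n)"
    and "\<And>n. property_M (\<mu> n) (E n)"
    and "equicoercive (\<lambda>n. extend_infty (E (enat n)) (I (enat n)))"
    and "Gamma_converges (\<lambda>n. extend_infty (E (enat n)) (I (enat n))) (extend_infty (E \<infinity>) (I \<infinity>))"
    and "\<And>n. global_weak_mode (\<mu> (enat n)) (u n)"
  shows "\<forall>\<phi> v. strict_mono \<phi> \<longrightarrow> (u \<circ> \<phi>) \<longlonglongrightarrow> v \<longrightarrow> global_weak_mode (\<mu> \<infinity>) v"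
proof (intro allI impI)
  fix \<phi> :: "nat \<Rightarrow> nat" and v
  assume "strict_mono \<phi>" "(u \<circ> \<phi>) \<longlonglongrightarrow> v"
  moreover have "extend_infty (E (enat n)) (I (enat n)) (u n)
      \<le> extend_infty (E (enat n)) (I (enat n)) x" for n x
    using assms(6) global_weak_mode_iff_minimiser[OF assms(2,3)] by blast
  ultimately have "extend_infty (E \<infinity>) (I \<infinity>) v \<le> extend_infty (E \<infinity>) (I \<infinity>) x" for x
    using Gamma_limit_of_minimisers[OF assms(5)] by blast
  then show "global_weak_mode (\<mu> \<infinity>) v"
    using global_weak_mode_iff_minimiser[OF assms(2,3)] by blast
qed

end
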